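(* Let $n\ge 2$. The maximum weight of the Steinhaus triangles of size $n$ is $w_m=\lceil n(n+1)/3\rceil$. Moreover, with $\mathbf{z}_1=\overline{110}[n]$, $\mathbf{z}_2=\overline{011}[n]$, $\mathbf{z}_3=\overline{101}[n]$: (i) if $n\equiv 0,2\pmod 3$, then $W_m=\{\mathbf{z}_1,\mathbf{z}_2,\mathbf{z}_3\}$; (ii) if $n\equiv 1\pmod 3$, then $W_m=\{\mathbf{z}_1,\mathbf{z}_3\}$.
   Context: For $\mathbf{x}=(x_0,\ldots,x_{n-1})\in\mathbb{F}_2^n$, the derivative is $\partial\mathbf{x}=(x_0+x_1,\ldots,x_{n-2}+x_{n-1})\in\mathbb{F}_2^{n-1}$, with $\partial^0\mathbf{x}=\mathbf{x}$ and $\partial^i\mathbf{x}=\partial(\partial^{i-1}\mathbf{x})$. The Steinhaus triangle is $T(\mathbf{x})=(\mathbf{x},\partial\mathbf{x},\ldots,\partial^{n-1}\mathbf{x})$; $|\mathbf{y}|$ is the number of ones of a binary sequence and $|T(\mathbf{x})|=\sum_{i=0}^{n-1}|\partial^i\mathbf{x}|$. For fixed $n$, let $0=w_0<w_1<\cdots<w_m$ be the distinct values of $|T(\mathbf{x})|$ over $\mathbf{x}\in\mathbb{F}_2^n$ (so $w_m$ is the maximum), and $W_i=\{\mathbf{x}\in\mathbb{F}_2^n:|T(\mathbf{x})|=w_i\}$. $\overline{x_1\cdots x_p}[k]$ is the word of the first $k$ letters of the infinite periodic word $x_1\cdots x_px_1\cdots x_p\cdots$. *)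

theory Defs
  imports Complex_Main "HOL-Library.Z2"
begin

text \<open>Binary sequences are lists over the field \<^typ>\<open>bit\<close> with two elements.\<close>

definition words :: "nat \<Rightarrow> bit list set" where
  "words n = {x. length x = n}"

definition derivative :: "bit list \<Rightarrow> bit list" where
  "derivative x = map (\<lambda>i. x ! i + x ! (i + 1)) [0..<length x - 1]"

definition steinhaus_triangle :: "bit list \<Rightarrow> bit list list" where
  "steinhaus_triangle x = map (\<lambda>i. (derivative ^^ i) x) [0..<length x]"

definition weight :: "bit list \<Rightarrow> nat" where
  "weight y = count_list y 1"

definition triangle_weight :: "bit list list \<Rightarrow> nat" where
  "triangle_weight T = (\<Sum>y\<leftarrow>T. weight y)"

definition weight_values :: "nat \<Rightarrow> nat set" where
  "weight_values n = (\<lambda>x. triangle_weight (steinhaus_triangle x)) ` words n"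

text \<open>
  The increasing enumeration \<open>w\<^sub>0 < w\<^sub>1 < \<dots> < w\<^sub>m\<close> of the distinct weights, the index \<open>m\<close> of
  the last one, and the set \<open>W\<^sub>i\<close> of sequences whose triangle has weight \<open>w\<^sub>i\<close>.
  The value \<open>nth_weight n i\<close> is meaningful only for \<open>i \<le> last_index n\<close>.
\<close>

definition nth_weight :: "nat \<Rightarrow> nat \<Rightarrow> nat" where
  "nth_weight n i = sorted_list_of_set (weight_values n) ! i"

definition last_index :: "nat \<Rightarrow> nat" where
  "last_index n = card (weight_values n) - 1"

definition weight_class :: "nat \<Rightarrow> nat \<Rightarrow> bit list set" where
  "weight_class n i =
     {x \<in> words n. triangle_weight (steinhaus_triangle x) = nth_weight n i}"

definition periodic_word :: "bit list \<Rightarrow> nat \<Rightarrow> bit list" where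
  "periodic_word p k = map (\<lambda>i. p ! (i mod length p)) [0..<k]"

end

theory Submission
  imports Defs
begin

text \<open>
  Write \<open>M n = \<lceil>n (n + 1) / 3\<rceil>\<close>. If the top row \<open>x\<close> has at most \<open>2 n / 3\<close> ones, remove it:
  \<open>|x| \<le> M n - M (n - 1)\<close>. Otherwise \<open>x\<close> has few zeros, and since each one of \<open>\<partial>x\<close> lies under
  a zero of \<open>x\<close> we get \<open>|x| + |\<partial>x| \<le> 2 n - |x|\<close>, which is at most \<open>M n - M (n - 2)\<close>; remove the
  two top rows. Induction gives the bound. In the case of equality, the remaining triangle is
  extremal, hence generated by a shift of \<open>110110\<dots>\<close>, whose antiderivatives are a shift of the
  same word or its complement; the complement contains too few ones once \<open>n \<ge> 7\<close>.
\<close>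

section \<open>Weights of triangles and the candidate extremal words\<close>

definition steinhaus_weight :: "bit list \<Rightarrow> nat" where
  "steinhaus_weight x = triangle_weight (steinhaus_triangle x)"

definition max_weight :: "nat \<Rightarrow> nat" where
  "max_weight n = (n * (n + 1) + 2) div 3"

text \<open>The zeros are the positions congruent to \<open>2 - c\<close> modulo 3, so
  \<open>c = 0, 1, 2\<close> give the words with periods 110, 101, 011.\<close>

definition shifted_110 :: "nat \<Rightarrow> nat \<Rightarrow> bit list" where
  "shifted_110 c n = map (\<lambda>i. of_bool ((i + c) mod 3 \<noteq> 2)) [0..<n]"

lemma length_derivative [simp]: "length (derivative x) = length x - 1"
  by (simp add: derivative_def)

lemma nth_derivative: "Suc i < length x \<Longrightarrow> derivative x ! i = x ! i + x ! Suc i"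
  by (simp add: derivative_def)

lemma derivative_Nil [simp]: "derivative [] = []"
  by (simp add: derivative_def)

lemma derivative_singleton [simp]: "derivative [a] = []"
  by (simp add: derivative_def)

lemma derivative_Cons_Cons [simp]: "derivative (a # b # x) = (a + b) # derivative (b # x)"
  by (rule nth_equalityI) (auto simp: nth_derivative nth_Cons split: nat.split)

lemma weight_simps [simp]:
  "weight [] = 0" "weight (a # x) = of_bool (a = 1) + weight x" "weight (x @ y) = weight x + weight y"
  by (auto simp: weight_def)

lemma steinhaus_weight_Nil [simp]: "steinhaus_weight [] = 0"
  by (simp add: steinhaus_weight_def steinhaus_triangle_def triangle_weight_def)

lemma steinhaus_weight_rec: "steinhaus_weight x = weight x + steinhaus_weight (derivative x)"
proof (cases "length x")
  case (Suc m)
  have "[0..<length x] = 0 # map Suc [0..<m]"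
    using Suc by (simp add: map_Suc_upt upt_conv_Cons del: upt_Suc)
  then show ?thesis
    by (simp add: steinhaus_weight_def steinhaus_triangle_def triangle_weight_def Suc
        funpow_Suc_right o_def del: funpow.simps upt_Suc)
qed auto

section \<open>The bound and its increments\<close>

lemma max_weight_0 [simp]: "max_weight 0 = 0"
  by (simp add: max_weight_def)

lemma max_weight_closed_forms:
  "max_weight (3 * k) = 3 * k * k + k"
  "max_weight (3 * k + 1) = 3 * k * k + 3 * k + 1"
  "max_weight (3 * k + 2) = 3 * k * k + 5 * k + 2"
  "max_weight (3 * k + 3) = 3 * k * k + 7 * k + 4"
  "max_weight (3 * k + 4) = 3 * k * k + 9 * k + 7"
  unfolding max_weight_def by (rule div_nat_eqI; simp add: algebra_simps)+

text \<open>The increments are linear in \<open>k\<close>, so \<open>max_weight n\<close> can stay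
  an opaque atom and the later estimates are linear arithmetic.\<close>

lemma max_weight_cases:
  fixes n :: nat
  obtains k where "n = 3 * k"
      "max_weight (Suc n) = max_weight n + 2 * k + 1"
      "max_weight (Suc (Suc n)) = max_weight n + 4 * k + 2"
  | k where "n = 3 * k + 1"
      "max_weight (Suc n) = max_weight n + 2 * k + 1"
      "max_weight (Suc (Suc n)) = max_weight n + 4 * k + 3"
  | k where "n = 3 * k + 2"
      "max_weight (Suc n) = max_weight n + 2 * k + 2"
      "max_weight (Suc (Suc n)) = max_weight n + 4 * k + 5"
proof -
  define k where "k = n div 3"
  consider "n = 3 * k" | "n = 3 * k + 1" | "n = 3 * k + 2"
    unfolding k_def by linarith
  then show ?thesis
  proof cases
    case 1
    then have n: "Suc n = 3 * k + 1" "Suc (Suc n) = 3 * k + 2" by simp_all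
    have "max_weight (Suc n) = max_weight n + 2 * k + 1"
      unfolding n(1) unfolding 1 max_weight_closed_forms by linarith
    moreover have "max_weight (Suc (Suc n)) = max_weight n + 4 * k + 2"
      unfolding n(2) unfolding 1 max_weight_closed_forms by linarith
    ultimately show ?thesis by (rule that(1)[OF 1])
  next
    case 2
    then have n: "Suc n = 3 * k + 2" "Suc (Suc n) = 3 * k + 3" by simp_all
    have "max_weight (Suc n) = max_weight n + 2 * k + 1"
      unfolding n(1) unfolding 2 max_weight_closed_forms by linarith
    moreover have "max_weight (Suc (Suc n)) = max_weight n + 4 * k + 3"
      unfolding n(2) unfolding 2 max_weight_closed_forms by linarith
    ultimately show ?thesis by (rule that(2)[OF 2])
  next
    case 3
    then have n: "Suc n = 3 * k + 3" "Suc (Suc n) = 3 * k + 4" by simp_all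
    have "max_weight (Suc n) = max_weight n + 2 * k + 2"
      unfolding n(1) unfolding 3 max_weight_closed_forms by linarith
    moreover have "max_weight (Suc (Suc n)) = max_weight n + 4 * k + 5"
      unfolding n(2) unfolding 3 max_weight_closed_forms by linarith
    ultimately show ?thesis by (rule that(3)[OF 3])
  qed
qed

lemma ceiling_third_eq_max_weight: "\<lceil>real (n * (n + 1)) / 3\<rceil> = int (max_weight n)"
proof -
  have "\<lceil>real m / 3\<rceil> = int ((m + 2) div 3)" for m
    by (rule ceiling_unique) linarith+
  then show ?thesis unfolding max_weight_def .
qed

text \<open>Every one of the derivative lies under a zero, and every zero is above at most two ones.\<close>
lemma weight_derivative_le: "weight (derivative x) + 2 * weight x \<le> 2 * length x"
proof -
  \<comment> \<open>The extra term strengthens the induction: a leading zero has a neighbour on one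
    side at most, and this slack pays for the new one of the derivative when 1 is put before a
    leading 0.\<close>
  have "weight (derivative (a # x)) + 2 * weight (a # x) + of_bool (a = 0) \<le> 2 * length (a # x)" for a x
  proof (induction x arbitrary: a)
    case (Cons b x)
    show ?case using Cons.IH[of b] by (cases a; cases b) simp_all
  qed simp
  from this[of "hd x" "tl x"] show ?thesis by (cases x) simp_all
qed

section \<open>The three shifts of 110110... and their antiderivatives\<close>

lemma length_shifted_110 [simp]: "length (shifted_110 c n) = n"
  by (simp add: shifted_110_def)

text \<open>The quotient counts the zeros: passing from \<open>n\<close> to \<open>Suc n\<close>
  raises it exactly when the letter added at position \<open>n\<close> is zero.\<close>

lemma weight_shifted_110: "c < 3 \<Longrightarrow> weight (shifted_110 c n) + (n + c) div 3 = n"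
proof (induction n)
  case (Suc n)
  then have "weight (shifted_110 c n) + (n + c) div 3 = n" by simp
  moreover have "(Suc n + c) div 3 = (n + c) div 3 + of_bool ((n + c) mod 3 = 2)"
    by (auto; presburger)
  ultimately show ?case by (auto simp: shifted_110_def)
qed (simp add: shifted_110_def)

lemma weight_shifted_110_bounds:
  assumes "c < 3"
  shows "2 * n \<le> 3 * weight (shifted_110 c n) + c" "3 * weight (shifted_110 c n) + c < 2 * n + 3"
  using weight_shifted_110[OF assms, of n] by linarith+

lemma weight_complement: "weight (map ((+) 1) x) + weight x = length x"
  by (induction x) auto

text \<open>Zeros are never adjacent, so neighbours sum to 0 only at the pair 11, which starts where
  \<open>i + c\<close> is divisible by 3.\<close>

lemma derivative_shifted_110:
  "derivative (shifted_110 c n) = shifted_110 ((c + 2) mod 3) (n - 1)"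
proof (rule nth_equalityI)
  fix i assume "i < length (derivative (shifted_110 c n))"
  moreover have "of_bool ((i + c) mod 3 \<noteq> 2) + of_bool ((Suc i + c) mod 3 \<noteq> 2)
      = (of_bool ((i + (c + 2) mod 3) mod 3 \<noteq> 2) :: bit)"
    by (cases "(i + c) mod 3 = 2"; cases "(Suc i + c) mod 3 = 2") (auto; presburger)+
  ultimately show "derivative (shifted_110 c n) ! i = shifted_110 ((c + 2) mod 3) (n - 1) ! i"
    by (simp add: nth_derivative shifted_110_def)
qed simp

text \<open>The first letter and the derivative determine a word, and there are only two choices for
  the first letter.\<close>

lemma derivative_eq_imp:
  assumes "derivative x = derivative y" "length x = length y"
  shows "x = y \<or> x = map ((+) 1) y"
proof (cases "x ! 0 = y ! 0")
  case True
  have "i < length x \<Longrightarrow> x ! i = y ! i" for i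
  proof (induction i)
    case (Suc i)
    then show ?case using nth_derivative[of i x] nth_derivative[of i y] assms
      by (cases "y ! i"; cases "y ! Suc i"; cases "x ! Suc i") auto
  qed (use True in auto)
  then show ?thesis using assms by (auto intro: nth_equalityI)
next
  case False
  have "i < length x \<Longrightarrow> x ! i = 1 + y ! i" for i
  proof (induction i)
    case 0
    show ?case using False by (cases "x ! 0"; cases "y ! 0") auto
  next
    case (Suc i)
    then show ?case using nth_derivative[of i x] nth_derivative[of i y] assms
      by (cases "y ! i"; cases "y ! Suc i"; cases "x ! Suc i") auto
  qed
  then show ?thesis using assms by (auto intro: nth_equalityI)
qed

lemma antiderivative_shifted_110:
  assumes "derivative x = shifted_110 c n" "length x = Suc n" "c < 3"
  obtains d where "d < 3" "x = shifted_110 d (Suc n) \<or> x = map ((+) 1) (shifted_110 d (Suc n))"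
proof
  \<comment> \<open>The derivative adds 2 to the shift modulo 3; adding 1 undoes this.\<close>
  have "((c + 1) mod 3 + 2) mod 3 = c" using assms(3) by presburger
  then have "derivative x = derivative (shifted_110 ((c + 1) mod 3) (Suc n))"
    using assms by (simp add: derivative_shifted_110)
  then show "x = shifted_110 ((c + 1) mod 3) (Suc n)
      \<or> x = map ((+) 1) (shifted_110 ((c + 1) mod 3) (Suc n))"
    by (rule derivative_eq_imp) (simp add: assms)
qed simp

text \<open>Removing the top row permutes the shifts cyclically, so the induction treats all
  \<open>c\<close> together. The defect of one originates at size 1, where shift 2 is the single
  letter 0.\<close>

lemma steinhaus_weight_shifted_110:
  "c < 3 \<Longrightarrow> steinhaus_weight (shifted_110 c n) + of_bool (n mod 3 = 1 \<and> c = 2) = max_weight n"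
proof (induction n arbitrary: c)
  case (Suc n)
  define d where "d = (c + 2) mod 3"
  have IH: "steinhaus_weight (shifted_110 d n) + of_bool (n mod 3 = 1 \<and> d = 2) = max_weight n"
    by (rule Suc.IH) (simp add: d_def)
  have rec: "steinhaus_weight (shifted_110 c (Suc n))
      = weight (shifted_110 c (Suc n)) + steinhaus_weight (shifted_110 d n)"
    by (subst steinhaus_weight_rec) (simp add: derivative_shifted_110 d_def)
  note w = weight_shifted_110_bounds[OF Suc.prems, of "Suc n"]
  have c: "c = 0 \<and> d = 2 \<or> c = 1 \<and> d = 0 \<or> c = 2 \<and> d = 1"
  proof -
    have "c = 0 \<or> c = 1 \<or> c = 2" using Suc.prems by linarith
    then show ?thesis unfolding d_def by auto
  qed
  have mod: "Suc (Suc (3 * k)) mod 3 = 2" for k by presburger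
  show ?case
    by (cases n rule: max_weight_cases) (use IH rec w c in \<open>auto simp: mod\<close>)
qed (simp add: shifted_110_def max_weight_def)

section \<open>The upper bound\<close>

lemma steinhaus_weight_le: "steinhaus_weight x \<le> max_weight (length x)"
proof (induction "length x" arbitrary: x rule: less_induct)
  case less
  consider "length x = 0" | "length x = 1" | m where "length x = Suc (Suc m)"
    by (metis One_nat_def nat.exhaust)
  then show ?case
  proof cases
    case 1
    then show ?thesis by simp
  next
    case 2
    then obtain a where "x = [a]" by (auto simp: length_Suc_conv)
    then show ?thesis using steinhaus_weight_rec[of "[a]"] by (simp add: max_weight_def)
  next
    case (3 m)
    have IH: "steinhaus_weight (derivative x) \<le> max_weight (Suc m)"
      "steinhaus_weight (derivative (derivative x)) \<le> max_weight m"
      using less[of "derivative x"] less[of "derivative (derivative x)"] 3 by simp_all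
    note rec = steinhaus_weight_rec[of x] steinhaus_weight_rec[of "derivative x"]
    note w = weight_derivative_le[of x, unfolded 3 mult_Suc_right]
    show ?thesis
      \<comment> \<open>The threshold is two thirds of the length \<open>m + 2\<close>; below it one
        row is removed, above it two.\<close>
      unfolding 3 by (cases m rule: max_weight_cases; cases "3 * weight x \<le> 2 * m + 4")
        (use IH rec w in linarith)+
  qed
qed

section \<open>Uniqueness of the extremal words\<close>

lemma small_steinhaus_weight_eq_max:
  assumes "steinhaus_weight x = max_weight (length x)" "length x \<le> 6"
  shows "\<exists>c<3. x = shifted_110 c (length x)"
proof -
  \<comment> \<open>The words too short for the inductive argument are checked exhaustively.\<close>
  have "\<forall>n\<in>set [0..<7]. \<forall>x\<in>set (List.n_lists n [0, 1]).
      steinhaus_weight x = max_weight n \<longrightarrow> x \<in> set (map (\<lambda>c. shifted_110 c n) [0..<3])"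
    by code_simp
  moreover have "set x \<subseteq> set [0, 1]" by (metis (full_types) bit_not_one_iff insertCI list.simps(15) subsetI)
  ultimately show ?thesis using assms by (force simp: set_n_lists)
qed

lemma steinhaus_weight_eq_max:
  assumes "steinhaus_weight x = max_weight (length x)"
  shows "\<exists>c<3. x = shifted_110 c (length x)"
  using assms
proof (induction "length x" arbitrary: x rule: less_induct)
  case less
  show ?case
  proof (cases "length x \<le> 6")
    case False
    define m where "m = length x - 2"
    have m: "length x = Suc (Suc m)" "m \<ge> 5" using False by (auto simp: m_def)
    note steps = steinhaus_weight_rec[of x] steinhaus_weight_rec[of "derivative x"] less.prems[unfolded m(1)]
    \<comment> \<open>Common end of both cases: about a third of the letters of a complement are
      ones, too few for the assumed weight of \<open>x\<close>.\<close>
    have x: ?thesis if c: "derivative x = shifted_110 c (Suc m)" "c < 3" and w: "2 * m + 3 \<le> 3 * weight x" for c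
    proof -
      obtain d where d: "d < 3"
        "x = shifted_110 d (Suc (Suc m)) \<or> x = map ((+) 1) (shifted_110 d (Suc (Suc m)))"
        using antiderivative_shifted_110[OF c(1) m(1) c(2)] by blast
      have "3 * weight (map ((+) 1) (shifted_110 d (Suc (Suc m)))) \<le> m + 4"
        using weight_complement[of "shifted_110 d (Suc (Suc m))"]
          weight_shifted_110_bounds[OF d(1), of "Suc (Suc m)"] d(1) by simp
      then show ?thesis using d w m by auto
    qed
    show ?thesis
    proof (cases "3 * weight x \<le> 2 * length x")
      case True
      have "steinhaus_weight (derivative x) \<le> max_weight (Suc m)"
        using steinhaus_weight_le[of "derivative x"] m by simp
      \<comment> \<open>For \<open>m = 3 * k + 2\<close> the increment \<open>2 * k + 3\<close>
        exceeds two thirds of the row, so the case is void; otherwise the estimate is tight.\<close>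
      then have eq: "steinhaus_weight (derivative x) = max_weight (Suc m) \<and> 2 * m + 3 \<le> 3 * weight x"
        by (cases m rule: max_weight_cases) (use True[unfolded m(1) mult_Suc_right] steps m in linarith)+
      obtain c where "c < 3" "derivative x = shifted_110 c (Suc m)"
        using less.hyps[of "derivative x"] eq m by auto
      then show ?thesis using x eq by blast
    next
      case False
      have "steinhaus_weight (derivative (derivative x)) \<le> max_weight m"
        using steinhaus_weight_le[of "derivative (derivative x)"] m by simp
      note w = this False[unfolded m(1) mult_Suc_right] steps
        weight_derivative_le[of x, unfolded m(1) mult_Suc_right]
      \<comment> \<open>The two-row estimate is tight as well. The second conjunct will exclude a
        complement as \<open>derivative x\<close>.\<close>
      have eq: "steinhaus_weight (derivative (derivative x)) = max_weight m \<and>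
          m + 3 < 3 * weight (derivative x)"
      proof (cases m rule: max_weight_cases)
        case (2 k)
        \<comment> \<open>Here \<open>3 * weight (derivative x) = 6 * k\<close>, which exceeds
          \<open>m + 3 = 3 * k + 4\<close> only from \<open>k = 2\<close> on; \<open>k = 1\<close>
          is length 6, which is why the exhaustive check reaches that far.\<close>
        moreover have "k \<ge> 2" using 2(1) m(2) by linarith
        ultimately show ?thesis using w by linarith
      qed (use w m(2) in linarith)+
      obtain c where "c < 3" "derivative (derivative x) = shifted_110 c m"
        using less.hyps[of "derivative (derivative x)"] eq m by auto
      then obtain d where d: "d < 3" "derivative x = shifted_110 d (Suc m)
          \<or> derivative x = map ((+) 1) (shifted_110 d (Suc m))"
        using antiderivative_shifted_110[of "derivative x" c m] m(1)
        by (metis diff_Suc_1 length_derivative)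
      have "3 * weight (map ((+) 1) (shifted_110 d (Suc m))) \<le> m + 3"
        using weight_complement[of "shifted_110 d (Suc m)"]
          weight_shifted_110_bounds[OF d(1), of "Suc m"] d(1) by simp
      then show ?thesis using d eq m x[of d] False by auto
    qed
  qed (use less.prems small_steinhaus_weight_eq_max in blast)
qed

section \<open>From the bound to the ordered list of weights\<close>

lemma finite_weight_values: "finite (weight_values n)"
proof -
  have "words n = {x. set x \<subseteq> {0, 1} \<and> length x = n}"
    by (auto simp: words_def)
  then have "finite (words n)" by (simp add: finite_lists_length_eq)
  then show ?thesis by (simp add: weight_values_def)
qed

lemma nth_weight_last_index: "nth_weight n (last_index n) = Max (weight_values n)"
proof -
  \<comment> \<open>The zero word makes the set of weights nonempty, so the truncated subtraction in
    \<open>last_index\<close> does yield the last position.\<close>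
  have "replicate n 0 \<in> words n" by (simp add: words_def)
  then have "weight_values n \<noteq> {}" by (auto simp: weight_values_def)
  then have ne: "sorted_list_of_set (weight_values n) \<noteq> []"
    using finite_weight_values by simp
  then have "nth_weight n (last_index n) = last (sorted_list_of_set (weight_values n))"
    by (simp add: nth_weight_def last_index_def last_conv_nth)
  moreover have "y \<le> last l" if "sorted l" "y \<in> set l" for y :: nat and l
    using that by (induction l) auto
  ultimately show ?thesis
    using ne finite_weight_values by (metis Max_eqI finite_set last_in_set set_sorted_list_of_set
        sorted_list_of_set.sorted_sorted_key_list_of_set)
qed

lemma shifted_110_eq_periodic_word:
  "shifted_110 0 n = periodic_word [1, 1, 0] n"
  "shifted_110 1 n = periodic_word [1, 0, 1] n"
  "shifted_110 2 n = periodic_word [0, 1, 1] n"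
proof -
  have i: "i mod 3 = 0 \<or> i mod 3 = 1 \<or> i mod 3 = 2" for i :: nat by presburger
  have "of_bool ((i + 0) mod 3 \<noteq> 2) = [1, 1, 0 :: bit] ! (i mod 3)"
    "of_bool ((i + 1) mod 3 \<noteq> 2) = [1, 0, 1 :: bit] ! (i mod 3)"
    "of_bool ((i + 2) mod 3 \<noteq> 2) = [0, 1, 1 :: bit] ! (i mod 3)" for i :: nat
    using i[of i] by (elim disjE; simp add: mod_Suc)+
  then show "shifted_110 0 n = periodic_word [1, 1, 0] n"
    "shifted_110 1 n = periodic_word [1, 0, 1] n"
    "shifted_110 2 n = periodic_word [0, 1, 1] n"
    by (simp_all add: shifted_110_def periodic_word_def flip: numeral_3_eq_3)
qed

lemma Max_weight_values: "Max (weight_values n) = max_weight n"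
proof (rule Max_eqI)
  show "finite (weight_values n)" by (rule finite_weight_values)
  show "w \<le> max_weight n" if "w \<in> weight_values n" for w
    using that steinhaus_weight_le
    by (auto simp: weight_values_def words_def simp flip: steinhaus_weight_def)
  \<comment> \<open>Shift 0 never has the defect, so it attains the bound for every
    \<open>n\<close>.\<close>
  have "steinhaus_weight (shifted_110 0 n) = max_weight n"
    using steinhaus_weight_shifted_110[of 0 n] by simp
  then show "max_weight n \<in> weight_values n"
    unfolding weight_values_def words_def steinhaus_weight_def[symmetric]
    by (metis (mono_tags, lifting) image_eqI length_shifted_110 mem_Collect_eq)
qed

text \<open>Extremal words are shifts, and the defect decides which shifts are extremal.\<close>

lemma weight_class_last_index:
  "weight_class n (last_index n) = {shifted_110 c n |c. c < 3 \<and> \<not> (n mod 3 = 1 \<and> c = 2)}"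
proof -
  have *: "steinhaus_weight (shifted_110 c n) = max_weight n \<longleftrightarrow> \<not> (n mod 3 = 1 \<and> c = 2)"
    if "c < 3" for c
    using steinhaus_weight_shifted_110[OF that, of n] by auto
  have "weight_class n (last_index n) = {x. length x = n \<and> steinhaus_weight x = max_weight n}"
    by (simp add: weight_class_def nth_weight_last_index Max_weight_values words_def steinhaus_weight_def)
  also have "\<dots> = {shifted_110 c n |c. c < 3 \<and> steinhaus_weight (shifted_110 c n) = max_weight n}"
    using steinhaus_weight_eq_max by fastforce
  also have "\<dots> = {shifted_110 c n |c. c < 3 \<and> \<not> (n mod 3 = 1 \<and> c = 2)}"
    using * by blast
  finally show ?thesis .
qed

theorem theorem7p9:
  fixes n :: nat
  assumes "n \<ge> 2"
  shows "Max (weight_values n) = nth_weight n (last_index n) \<and>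
    int (nth_weight n (last_index n)) = \<lceil>real (n * (n + 1)) / 3\<rceil> \<and>
    (n mod 3 = 0 \<or> n mod 3 = 2 \<longrightarrow>
       weight_class n (last_index n) =
         {periodic_word [1, 1, 0] n, periodic_word [0, 1, 1] n, periodic_word [1, 0, 1] n}) \<and>
    (n mod 3 = 1 \<longrightarrow>
       weight_class n (last_index n) = {periodic_word [1, 1, 0] n, periodic_word [1, 0, 1] n})"
proof -
  have c: "c < 3 \<longleftrightarrow> c = 0 \<or> c = 1 \<or> c = 2" for c :: nat by auto
  have other: "weight_class n (last_index n) = {shifted_110 0 n, shifted_110 2 n, shifted_110 1 n}"
    if "n mod 3 \<noteq> 1"
    unfolding weight_class_last_index c using that by blast
  have one: "weight_class n (last_index n) = {shifted_110 0 n, shifted_110 1 n}"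
    if "n mod 3 = 1"
  proof -
    have "{shifted_110 c n |c. (c = 0 \<or> c = 1 \<or> c = 2) \<and> c \<noteq> 2} = {shifted_110 0 n, shifted_110 1 n}"
      by force
    then show ?thesis unfolding weight_class_last_index c using that by simp
  qed
  show ?thesis
    unfolding shifted_110_eq_periodic_word[symmetric]
  proof (intro conjI impI)
    show "Max (weight_values n) = nth_weight n (last_index n)"
      by (simp only: nth_weight_last_index)
    show "int (nth_weight n (last_index n)) = \<lceil>real (n * (n + 1)) / 3\<rceil>"
      by (simp only: nth_weight_last_index Max_weight_values ceiling_third_eq_max_weight)
  qed (use other one in force)+
qed

end
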